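(* For any $\gamma>0$ and $s\ge \Omega(1/\gamma^2)$, there is a function $F:\{-1,1\}^N\to\{-1,1\}$ such that: 1. ($F$ is mildly hard for size-$s$ circuits) every circuit of size $s$ agrees with $F$ on at most $99\%$ of the inputs in $\{-1,1\}^N$; 2. (for every hardcore distribution, $F$ is mildly correlated with a small circuit) for every distribution $H$ over $\{-1,1\}^N$ of constant density, there is a circuit $C$ of size $O(s\gamma^2)$ with $\Pr_{\mathbf{X}\sim H}[C(\mathbf{X})=F(\mathbf{X})]\ge \tfrac12+\gamma$.
   Context: Boolean values are written as $\{-1,1\}$; circuits are standard Boolean circuits (with $\{-1,1\}$ identified with $\{0,1\}$), and size is the number of gates. A probability distribution $H$ over a finite set $\mathcal X$ has density $c\in(0,1]$ if $H(x)\le \frac{1}{c|\mathcal X|}$ for all $x\in\mathcal X$; "constant density" means density $c$ for a fixed constant $c>0$, and the asymptotic notation $O(\cdot),\Omega(\cdot)$ hides constants that may depend on $c$.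
   Formalization: The claim is stated for 0 < γ ≤ 1/2 instead of any γ > 0, since for γ > 1/2 item 2 would require a probability 1/2 + γ greater than 1, which fails already for the uniform distribution. *)

theory Defs
  imports "HOL-Probability.Probability"
begin

definition sign_cube :: "nat \<Rightarrow> (nat \<Rightarrow> int) set" where
  "sign_cube N = {..<N} \<rightarrow>\<^sub>E {-1, 1}"

(* The identification of {-1,1} with truth values: -1 is True and 1 is False. *)
definition sign_of_bool :: "bool \<Rightarrow> int" where
  "sign_of_bool b = (if b then -1 else 1)"

definition bool_of_sign :: "int \<Rightarrow> bool" where
  "bool_of_sign a \<longleftrightarrow> a = -1"

(* Circuits are DAGs over the basis of NOT and fan-in two AND, OR, with unbounded fan-out,
   listed in topological order.  On N inputs, wire j < N carries the j-th input and
   wire N + i carries the output of the i-th gate; gate arguments are wire numbers. *)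
datatype gate = And nat nat | Or nat nat | Not nat

datatype circuit = Circuit (gates: "gate list") (out_wire: nat)

fun gate_args :: "gate \<Rightarrow> nat set" where
  "gate_args (And i j) = {i, j}"
| "gate_args (Or i j) = {i, j}"
| "gate_args (Not i) = {i}"

definition wf_circuit :: "nat \<Rightarrow> circuit \<Rightarrow> bool" where
  "wf_circuit N C \<longleftrightarrow>
     (\<forall>i < length (gates C). \<forall>j \<in> gate_args (gates C ! i). j < N + i) \<and>
     out_wire C < N + length (gates C)"

definition circuit_size :: "circuit \<Rightarrow> nat" where
  "circuit_size C = length (gates C)"

fun gate_val :: "bool list \<Rightarrow> gate \<Rightarrow> bool" where
  "gate_val ws (And i j) \<longleftrightarrow> ws ! i \<and> ws ! j"
| "gate_val ws (Or i j) \<longleftrightarrow> ws ! i \<or> ws ! j"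
| "gate_val ws (Not i) \<longleftrightarrow> \<not> ws ! i"

definition wire_vals :: "gate list \<Rightarrow> bool list \<Rightarrow> bool list" where
  "wire_vals gs xs = fold (\<lambda>g ws. ws @ [gate_val ws g]) gs xs"

definition circuit_fun :: "nat \<Rightarrow> circuit \<Rightarrow> (nat \<Rightarrow> int) \<Rightarrow> int" where
  "circuit_fun N C x =
     sign_of_bool (wire_vals (gates C) (map (\<lambda>i. bool_of_sign (x i)) [0..<N]) ! out_wire C)"

definition has_density :: "'a pmf \<Rightarrow> 'a set \<Rightarrow> real \<Rightarrow> bool" where
  "has_density H X c \<longleftrightarrow>
     set_pmf H \<subseteq> X \<and> (\<forall>x \<in> X. pmf H x \<le> 1 / (c * real (card X)))"

end

theory Submission
  imports Defs
begin

text \<open>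
  Split the input into \<open>x\<close> with \<open>k\<close> bits and \<open>y\<close> with \<open>B * M\<close> bits, where \<open>k\<close> is of order
  \<open>(c / \<gamma>)\<^sup>2\<close> and odd, \<open>B\<close> is of order \<open>s / k\<close>, and \<open>M\<close> is large. The hard function is the majority
  of the \<open>k\<close> characters \<open>x\<^sub>i * (\<Prod>t\<in>U\<^sub>i. y\<^sub>t)\<close> for suitable \<open>B\<close>-element sets \<open>U\<^sub>i\<close>.

  The private bits \<open>x\<^sub>i\<close> make the characters independent and uniform, so their sum takes each value
  with probability at most \<open>1 / sqrt k\<close>. Under a distribution of density \<open>c\<close> the absolute value of
  the sum is therefore of order \<open>c * sqrt k\<close> on average, and so one of the characters has correlation
  of order \<open>c / sqrt k\<close> with the majority. A character is an xor of \<open>B + 1\<close> bits, hence is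
  computed by \<open>4 * B\<close> gates.

  For hardness, fix a circuit. Tuples whose majority the circuit computes on more than \<open>99%\<close> of the
  inputs have character sums correlated with the circuit. Since distinct characters are orthogonal,
  many such tuples cannot be pairwise far apart in Hamming distance, and only a fraction of about
  \<open>M ^ (- B * k / 20)\<close> of the tuples is good for the circuit. There are at most
  \<open>M ^ (10 * s)\<close> circuits, so some tuple is good for none. Using characters with many input bits to
  choose from, rather than arbitrary functions of few bits, is what supplies enough entropy to beat
  the factor \<open>ln s\<close> in the exponent of the number of circuits.
\<close>

subsection \<open>Characters of the sign cube\<close>

lemma finite_sign_cube [simp]: "finite (sign_cube N)"
  by (simp add: sign_cube_def finite_PiE)

lemma card_sign_cube: "card (sign_cube N) = 2 ^ N"
  by (simp add: sign_cube_def card_PiE numeral_2_eq_2)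

lemma sign_cube_values: "x \<in> sign_cube N \<Longrightarrow> t < N \<Longrightarrow> x t = -1 \<or> x t = 1"
  by (auto simp: sign_cube_def PiE_def Pi_def)

text \<open>Negating coordinate \<open>t\<close> is an involution of the cube, so the sum equals its
  own negative. All vanishing mixed moments below come from this.\<close>

lemma sum_sign_cube_flip:
  fixes h :: "(nat \<Rightarrow> int) \<Rightarrow> real"
  assumes "t < N" and "\<And>x. x \<in> sign_cube N \<Longrightarrow> h (x(t := - x t)) = - h x"
  shows "(\<Sum>x\<in>sign_cube N. h x) = 0"
proof -
  have mem: "x(t := - x t) \<in> sign_cube N" if "x \<in> sign_cube N" for x
    using that assms(1) by (auto simp: sign_cube_def PiE_def Pi_def extensional_def)
  have "(\<Sum>x\<in>sign_cube N. h x) = (\<Sum>x\<in>sign_cube N. h (x(t := - x t)))"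
    by (rule sum.reindex_bij_witness[where i = "\<lambda>x. x(t := - x t)" and j = "\<lambda>x. x(t := - x t)"])
       (auto simp: mem)
  also have "\<dots> = - (\<Sum>x\<in>sign_cube N. h x)"
    by (simp add: assms(2) sum_negf)
  finally show ?thesis by simp
qed

definition character :: "nat set \<Rightarrow> (nat \<Rightarrow> int) \<Rightarrow> int" where
  "character T x = (\<Prod>t\<in>T. x t)"

lemma character_values:
  assumes "x \<in> sign_cube N" and "T \<subseteq> {..<N}"
  shows "character T x = -1 \<or> character T x = 1"
proof -
  have "finite T" using assms(2) finite_subset by blast
  then show ?thesis using assms(2)
  proof (induction T)
    case (insert t T)
    then show ?case using sign_cube_values[OF assms(1), of t] by (auto simp: character_def)
  qed (simp add: character_def)
qed

lemma character_sq: "x \<in> sign_cube N \<Longrightarrow> T \<subseteq> {..<N} \<Longrightarrow> character T x * character T x = 1"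
  using character_values[of x N T] by auto

lemma character_flip_in:
  "finite T \<Longrightarrow> t \<in> T \<Longrightarrow> character T (x(t := - x t)) = - character T x"
  unfolding character_def
  by (subst (1 2) prod.remove[of T t]) (auto intro!: prod.cong)

lemma character_flip_notin: "t \<notin> T \<Longrightarrow> character T (x(t := a)) = character T x"
  unfolding character_def by (auto intro!: prod.cong)

text \<open>Flipping a coordinate that lies in exactly one of two distinct sets changes the sign of
  exactly one factor.\<close>

lemma character_orthogonal:
  assumes "T \<subseteq> {..<N}" and "T' \<subseteq> {..<N}"
  shows "(\<Sum>x\<in>sign_cube N. real_of_int (character T x * character T' x))
    = (if T = T' then 2 ^ N else 0)"
proof (cases "T = T'")
  case True
  then show ?thesis using assms by (simp add: character_sq card_sign_cube)
next
  case False
  then obtain t where t: "t \<in> T \<and> t \<notin> T' \<or> t \<in> T' \<and> t \<notin> T" by blast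
  have "finite T" "finite T'" using assms finite_subset by blast+
  with t have "(\<Sum>x\<in>sign_cube N. real_of_int (character T x * character T' x)) = 0"
    using assms
    by (intro sum_sign_cube_flip[of t])
       (auto simp: character_flip_in character_flip_notin)
  then show ?thesis using False by simp
qed

text \<open>The indices below \<open>k\<close> double as private input bits: once each
  \<open>U i\<close> lies in \<open>{k..<N}\<close>, coordinate \<open>i\<close> occurs in the
  \<open>i\<close>-th character only.\<close>

definition character_sum :: "nat \<Rightarrow> (nat \<Rightarrow> nat set) \<Rightarrow> (nat \<Rightarrow> int) \<Rightarrow> int" where
  "character_sum k U x = (\<Sum>i<k. character (insert i (U i)) x)"

definition character_majority :: "nat \<Rightarrow> (nat \<Rightarrow> nat set) \<Rightarrow> (nat \<Rightarrow> int) \<Rightarrow> int" where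
  "character_majority k U x = (if character_sum k U x \<ge> 0 then 1 else -1)"

text \<open>Averaged over inputs, this turns the mean absolute character sum into the total
  correlation of the majority with its characters.\<close>

lemma majority_mult_sum: "character_majority k U x * character_sum k U x = \<bar>character_sum k U x\<bar>"
  by (simp add: character_majority_def)

text \<open>This is \<open>k\<close> minus the Hamming distance of the two tuples.\<close>

definition agreement :: "nat \<Rightarrow> (nat \<Rightarrow> nat set) \<Rightarrow> (nat \<Rightarrow> nat set) \<Rightarrow> nat" where
  "agreement k U V = card {i. i < k \<and> U i = V i}"

text \<open>By orthogonality only pairs of equal sets contribute, and the private bit of such a set
  reveals its index.\<close>

lemma sum_character_sum_mult:
  assumes "k \<le> N" and U: "\<And>i. i < k \<Longrightarrow> U i \<subseteq> {k..<N}" and V: "\<And>i. i < k \<Longrightarrow> V i \<subseteq> {k..<N}"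
  shows "(\<Sum>x\<in>sign_cube N. real_of_int (character_sum k U x * character_sum k V x))
    = real (agreement k U V) * 2 ^ N"
proof -
  have sub: "insert i (U i) \<subseteq> {..<N}" "insert i (V i) \<subseteq> {..<N}" if "i < k" for i
    using U[OF that] V[OF that] that assms(1) by auto
  have eq: "insert i (U i) = insert j (V j) \<longleftrightarrow> i = j \<and> U i = V i" if "i < k" "j < k" for i j
  proof
    assume e: "insert i (U i) = insert j (V j)"
    have n: "i \<notin> U i" "j \<notin> V j" "i \<notin> V j" "j \<notin> U i"
      using U[OF that(1)] V[OF that(2)] that by auto
    with e have "i = j" by blast
    with e n show "i = j \<and> U i = V i" by (metis insert_ident)
  qed auto
  have "(\<Sum>x\<in>sign_cube N. real_of_int (character_sum k U x * character_sum k V x))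
    = (\<Sum>x\<in>sign_cube N. \<Sum>i<k. \<Sum>j<k.
        real_of_int (character (insert i (U i)) x * character (insert j (V j)) x))"
    by (simp add: character_sum_def sum_product)
  also have "\<dots> = (\<Sum>i<k. \<Sum>j<k. \<Sum>x\<in>sign_cube N.
        real_of_int (character (insert i (U i)) x * character (insert j (V j)) x))"
    by (subst sum.swap) (intro sum.cong refl sum.swap)
  also have "\<dots> = (\<Sum>i<k. \<Sum>j<k. if j = i then (if U i = V i then 2 ^ N else 0) else 0)"
    using sub by (intro sum.cong refl) (subst character_orthogonal, auto simp: eq)
  also have "\<dots> = (\<Sum>i<k. if U i = V i then 2 ^ N else 0)"
    by (intro sum.cong refl) (subst sum.delta, auto)
  also have "\<dots> = real (agreement k U V) * 2 ^ N"
    by (simp add: agreement_def sum.If_cases Int_def)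
  finally show ?thesis .
qed

text \<open>Induction adds one character \<open>f\<close> to the partial sum \<open>g\<close>. The
  private bit of \<open>f\<close> does not occur in \<open>g\<close>, so the terms odd in
  \<open>f\<close> sum to zero; the others raise the fourth moment by \<open>6 * m + 1\<close>, at
  most \<open>3 * (m + 1)\<^sup>2 - 3 * m\<^sup>2\<close>.\<close>

lemma sum_character_sum_moments:
  assumes "k \<le> N" and U: "\<And>i. i < k \<Longrightarrow> U i \<subseteq> {k..<N}" and "m \<le> k"
  shows "(\<Sum>x\<in>sign_cube N. real_of_int (character_sum m U x) ^ 2) = real m * 2 ^ N \<and>
    (\<Sum>x\<in>sign_cube N. real_of_int (character_sum m U x) ^ 4) \<le> 3 * real m ^ 2 * 2 ^ N"
  using \<open>m \<le> k\<close>
proof (induction m)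
  case 0
  then show ?case by (simp add: character_sum_def)
next
  case (Suc m)
  define f where "f x = real_of_int (character (insert m (U m)) x)" for x
  define g where "g x = real_of_int (character_sum m U x)" for x
  have sub: "insert m (U m) \<subseteq> {..<N}" and fin: "finite (insert m (U m))"
    using U[of m] Suc.prems assms(1) by (auto intro: finite_subset)
  have f2: "f x * f x = 1" if "x \<in> sign_cube N" for x
    using character_sq[OF that sub] unfolding f_def by (metis of_int_1 of_int_mult)
  have f_flip: "f (x(m := - x m)) = - f x" for x
    using character_flip_in[OF fin, of m x] by (simp add: f_def)
  have g_flip: "g (x(m := - x m)) = g x" for x
  proof -
    have "character (insert i (U i)) (x(m := - x m)) = character (insert i (U i)) x" if "i < m" for i
      using U[of i] Suc.prems that by (intro character_flip_notin) auto
    then show ?thesis by (simp add: g_def character_sum_def)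
  qed
  have z1: "(\<Sum>x\<in>sign_cube N. g x * f x) = 0" and z3: "(\<Sum>x\<in>sign_cube N. g x ^ 3 * f x) = 0"
    using Suc.prems assms(1) by (auto intro!: sum_sign_cube_flip[of m] simp: f_flip g_flip)
  have G: "real_of_int (character_sum (Suc m) U x) = g x + f x" for x
    by (simp add: character_sum_def f_def g_def)
  have IH: "(\<Sum>x\<in>sign_cube N. g x ^ 2) = real m * 2 ^ N"
    "(\<Sum>x\<in>sign_cube N. g x ^ 4) \<le> 3 * real m ^ 2 * 2 ^ N"
    using Suc unfolding g_def by auto
  have "(\<Sum>x\<in>sign_cube N. (g x + f x) ^ 2) = (\<Sum>x\<in>sign_cube N. g x ^ 2 + 2 * (g x * f x) + 1)"
    by (intro sum.cong refl) (use f2 in \<open>simp add: power2_eq_square algebra_simps\<close>)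
  also have "\<dots> = real (Suc m) * 2 ^ N"
    unfolding sum.distrib sum_distrib_left[symmetric] z1 IH
    by (simp add: card_sign_cube algebra_simps)
  finally have A: "(\<Sum>x\<in>sign_cube N. (g x + f x) ^ 2) = real (Suc m) * 2 ^ N" .
  have exp4: "(a + b) ^ 4 = a ^ 4 + 4 * (a ^ 3 * b) + 6 * a ^ 2 + 4 * (a * b) + 1"
    if "b * b = 1" for a b :: real
  proof -
    have "(a + b) ^ 4 = a ^ 4 + 4 * (a ^ 3 * b) + 6 * a ^ 2 * (b * b) + 4 * (a * b) * (b * b)
        + (b * b) * (b * b)"
      by (simp add: power2_eq_square power3_eq_cube power4_eq_xxxx algebra_simps)
    then show ?thesis using that by simp
  qed
  have "(\<Sum>x\<in>sign_cube N. (g x + f x) ^ 4)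
      = (\<Sum>x\<in>sign_cube N. g x ^ 4 + 4 * (g x ^ 3 * f x) + 6 * g x ^ 2 + 4 * (g x * f x) + 1)"
    using f2 by (intro sum.cong refl exp4)
  also have "\<dots> = (\<Sum>x\<in>sign_cube N. g x ^ 4) + 6 * (real m * 2 ^ N) + 2 ^ N"
    unfolding sum.distrib sum_distrib_left[symmetric] z1 z3 IH(1)
    by (simp add: card_sign_cube)
  also have "\<dots> \<le> (3 * real m ^ 2 + 6 * real m + 1) * 2 ^ N"
    using IH(2) by (simp add: algebra_simps)
  also have "\<dots> \<le> 3 * real (Suc m) ^ 2 * 2 ^ N"
    by (intro mult_right_mono) (auto simp: power2_eq_square algebra_simps)
  finally show ?case using A by (simp add: G)
qed

subsection \<open>Majorities of characters are rarely approximated by a fixed function\<close>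

text \<open>With \<open>u = \<bar>g\<bar> / q\<close> the claim is
  \<open>(u - 3 / 2)\<^sup>2 * (u + 3) * u \<ge> 0\<close>, tight at \<open>u = 3 / 2\<close>. Only
  the second and fourth powers of \<open>g\<close> enter, and these have computable moments.\<close>

lemma abs_ge_quartic:
  fixes g q :: real
  assumes "q > 0"
  shows "g\<^sup>2 / q - 4 * g ^ 4 / (27 * q ^ 3) \<le> \<bar>g\<bar>"
proof -
  define u where "u = \<bar>g\<bar> / q"
  have u: "u \<ge> 0" "\<bar>g\<bar> = u * q" using assms by (auto simp: u_def)
  have "0 \<le> (u - 3 / 2)\<^sup>2 * (u + 3) * u" using u by simp
  also have "(u - 3 / 2)\<^sup>2 * (u + 3) * u = 27 / 4 * (u - u\<^sup>2 + 4 * u ^ 4 / 27)"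
    by (simp add: power2_eq_square power4_eq_xxxx algebra_simps)
  finally have "u\<^sup>2 - 4 * u ^ 4 / 27 \<le> u" by simp
  then have "(u\<^sup>2 - 4 * u ^ 4 / 27) * q \<le> u * q" using assms by (intro mult_right_mono) auto
  moreover have "g\<^sup>2 = (u * q)\<^sup>2" "g ^ 4 = (u * q) ^ 4"
    using u(2) by (metis power2_abs, metis even_numeral power_even_abs)
  moreover have "(u * q)\<^sup>2 / q - 4 * (u * q) ^ 4 / (27 * q ^ 3) = (u\<^sup>2 - 4 * u ^ 4 / 27) * q"
    using assms by (simp add: power2_eq_square power3_eq_cube power4_eq_xxxx field_simps)
  ultimately show ?thesis using u(2) by metis
qed

text \<open>The quartic lower bound on \<open>\<bar>g\<bar>\<close> turns the second and fourth moments of the character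
  sum \<open>g\<close> into a mean of at least \<open>5 / 9 * sqrt k\<close>; the one percent of disagreement costs at most
  \<open>1 / 5 * sqrt k\<close> by AM-GM.\<close>

lemma agreeing_function_correlation:
  fixes h :: "(nat \<Rightarrow> int) \<Rightarrow> int"
  assumes "0 < k" "k \<le> N" and U: "\<And>i. i < k \<Longrightarrow> U i \<subseteq> {k..<N}"
    and h: "h \<in> sign_cube N \<rightarrow> {-1, 1}"
    and agree: "99 / 100 * 2 ^ N < real (card {x \<in> sign_cube N. h x = character_majority k U x})"
  shows "16 / 45 * sqrt k * 2 ^ N \<le> (\<Sum>x\<in>sign_cube N. real_of_int (h x * character_sum k U x))"
proof -
  define q where "q = sqrt (real k)"
  have q: "q > 0" "q * q = real k" using assms(1) by (auto simp: q_def)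
  define F where "F = character_majority k U"
  define g where "g x = real_of_int (character_sum k U x)" for x
  define D where "D = {x \<in> sign_cube N. h x \<noteq> F x}"
  have "card (sign_cube N) = card {x \<in> sign_cube N. h x = F x} + card D"
    unfolding D_def by (subst card_Un_disjoint[symmetric]) (auto intro!: arg_cong[where f = card])
  then have "real (card {x \<in> sign_cube N. h x = F x}) + real (card D) = 2 ^ N"
    by (metis card_sign_cube of_nat_add of_nat_numeral of_nat_power)
  then have D: "real (card D) \<le> 2 ^ N / 100" using agree by (simp add: F_def)
  \<comment> \<open>Of the \<open>1 / q\<close> in the quartic bound, \<open>1 / (10 * q)\<close> is
    held back: a disagreement costs
    \<open>2 * \<bar>g x\<bar> \<le> 10 * q + g x ^ 2 / (10 * q)\<close>, and only
    \<open>10 * q\<close> is charged to \<open>D\<close>.\<close>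
  have ptw: "9 / (10 * q) * g x ^ 2 - 4 / (27 * q ^ 3) * g x ^ 4 - 10 * q * (if x \<in> D then 1 else 0)
      \<le> real_of_int (h x * character_sum k U x)" if x: "x \<in> sign_cube N" for x
  proof -
    have Fg: "real_of_int (F x) * g x = \<bar>g x\<bar>"
      using majority_mult_sum[of k U x] unfolding F_def g_def by (metis of_int_abs of_int_mult)
    have Fv: "F x = 1 \<or> F x = -1" by (simp add: F_def character_majority_def)
    have hv: "h x = 1 \<or> h x = -1" using h x by auto
    have quart: "g x ^ 2 / q - 4 * g x ^ 4 / (27 * q ^ 3) \<le> \<bar>g x\<bar>" by (rule abs_ge_quartic[OF q(1)])
    have split: "9 / (10 * q) * g x ^ 2 - 4 / (27 * q ^ 3) * g x ^ 4
        = g x ^ 2 / q - 4 * g x ^ 4 / (27 * q ^ 3) - g x ^ 2 / (10 * q)"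
      using q(1) by (simp add: field_simps)
    show ?thesis
    proof (cases "x \<in> D")
      case False
      then have "real_of_int (h x * character_sum k U x) = \<bar>g x\<bar>"
        using x Fg by (simp add: D_def g_def)
      moreover have "g x ^ 2 / (10 * q) \<ge> 0" using q(1) by simp
      ultimately show ?thesis using False quart split by simp
    next
      case True
      then have "h x = - F x" using Fv hv by (auto simp: D_def)
      then have "real_of_int (h x * character_sum k U x) = - \<bar>g x\<bar>"
        using Fg by (simp add: g_def)
      moreover have "2 * \<bar>g x\<bar> \<le> 10 * q + g x ^ 2 / (10 * q)"
      proof -
        have "0 \<le> (\<bar>g x\<bar> - 10 * q)\<^sup>2" by simp
        also have "\<dots> = g x ^ 2 + 100 * q ^ 2 - 20 * q * \<bar>g x\<bar>"
          by (simp add: power2_diff power_mult_distrib algebra_simps)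
        finally show ?thesis using q(1) by (simp add: field_simps power2_eq_square)
      qed
      ultimately show ?thesis using True quart split by simp
    qed
  qed
  have S2: "(\<Sum>x\<in>sign_cube N. g x ^ 2) = real k * 2 ^ N"
    and S4: "(\<Sum>x\<in>sign_cube N. g x ^ 4) \<le> 3 * real k ^ 2 * 2 ^ N"
    unfolding g_def using sum_character_sum_moments[of k N U k, OF assms(2) U] by auto
  \<comment> \<open>The three terms are \<open>9 / 10\<close>, \<open>4 / 9\<close> and
    \<open>1 / 10\<close> times \<open>q * 2 ^ N\<close>.\<close>
  have "16 / 45 * q * 2 ^ N
      = 9 / (10 * q) * (real k * 2 ^ N) - 4 / (27 * q ^ 3) * (3 * real k ^ 2 * 2 ^ N)
        - 10 * q * (2 ^ N / 100)"
    unfolding q(2)[symmetric] using q(1) by (simp add: field_simps power2_eq_square power3_eq_cube)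
  also have "\<dots> \<le> 9 / (10 * q) * (\<Sum>x\<in>sign_cube N. g x ^ 2)
      - 4 / (27 * q ^ 3) * (\<Sum>x\<in>sign_cube N. g x ^ 4) - 10 * q * real (card D)"
    unfolding S2 using S4 D q(1) by (intro diff_mono mult_left_mono order_refl) auto
  also have "real (card D) = (\<Sum>x\<in>sign_cube N. if x \<in> D then 1 else 0)"
    by (simp add: sum.If_cases D_def Int_def conj_commute)
  also have "9 / (10 * q) * (\<Sum>x\<in>sign_cube N. g x ^ 2)
      - 4 / (27 * q ^ 3) * (\<Sum>x\<in>sign_cube N. g x ^ 4)
      - 10 * q * (\<Sum>x\<in>sign_cube N. if x \<in> D then 1 else 0)
    = (\<Sum>x\<in>sign_cube N. 9 / (10 * q) * g x ^ 2 - 4 / (27 * q ^ 3) * g x ^ 4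
        - 10 * q * (if x \<in> D then 1 else 0))"
    unfolding sum_subtractf sum_distrib_left ..
  also have "\<dots> \<le> (\<Sum>x\<in>sign_cube N. real_of_int (h x * character_sum k U x))"
    by (intro sum_mono ptw)
  finally show ?thesis by (simp add: q_def)
qed

text \<open>Union bound over the set \<open>A\<close> of positions where \<open>V\<close> copies
  \<open>U\<close>: there are at most \<open>2 ^ k\<close> such sets, and each leaves at most
  \<open>k - r\<close> entries free.\<close>

lemma card_agreement_ball:
  assumes "finite \<U>" and "U \<in> {..<k} \<rightarrow>\<^sub>E \<U>" and "r \<le> k"
  shows "card {V \<in> {..<k} \<rightarrow>\<^sub>E \<U>. r \<le> agreement k U V} \<le> 2 ^ k * card \<U> ^ (k - r)"
\<comment> \<open>Raising the exponent to \<open>k - r\<close> needs a base of at least 1, so an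
  empty \<open>\<U>\<close> is treated apart.\<close>
proof (cases "\<U> = {}")
  case True
  then show ?thesis using assms by (cases "k = 0") (auto simp: PiE_eq_empty_iff card_eq_0_iff)
next
  case False
  then have pos: "card \<U> > 0" using assms(1) by (simp add: card_gt_0_iff)
  define E where "E A = (\<Pi>\<^sub>E i\<in>{..<k}. if i \<in> A then {U i} else \<U>)" for A
  have finE: "finite (E A)" for A using assms(1) by (auto simp: E_def intro!: finite_PiE)
  have cardE: "card (E A) = card \<U> ^ (k - card A)" if "A \<subseteq> {..<k}" for A
  proof -
    have "card (E A) = (\<Prod>i<k. if i \<in> A then 1 else card \<U>)"
      unfolding E_def by (subst card_PiE) (auto intro!: prod.cong)
    also have "\<dots> = card \<U> ^ card ({..<k} - A)"
      by (simp add: prod.If_cases Diff_eq)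
    also have "card ({..<k} - A) = k - card A"
      using that by (subst card_Diff_subset) (auto intro: finite_subset)
    finally show ?thesis .
  qed
  define \<A> where "\<A> = {A. A \<subseteq> {..<k} \<and> r \<le> card A}"
  have \<A>: "finite \<A>" "card \<A> \<le> 2 ^ k"
  proof -
    have sub: "\<A> \<subseteq> Pow {..<k}" by (auto simp: \<A>_def)
    then show "finite \<A>" by (rule finite_subset) simp
    show "card \<A> \<le> 2 ^ k" using card_mono[OF _ sub] by (simp add: card_Pow)
  qed
  have "{V \<in> {..<k} \<rightarrow>\<^sub>E \<U>. r \<le> agreement k U V} \<subseteq> (\<Union>A\<in>\<A>. E A)"
  proof
    fix V assume V: "V \<in> {V \<in> {..<k} \<rightarrow>\<^sub>E \<U>. r \<le> agreement k U V}"
    then have "{i. i < k \<and> U i = V i} \<in> \<A>" by (auto simp: \<A>_def agreement_def)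
    moreover have "V \<in> E {i. i < k \<and> U i = V i}" using V by (auto simp: E_def PiE_def Pi_def)
    ultimately show "V \<in> (\<Union>A\<in>\<A>. E A)" by blast
  qed
  then have "card {V \<in> {..<k} \<rightarrow>\<^sub>E \<U>. r \<le> agreement k U V} \<le> card (\<Union>A\<in>\<A>. E A)"
    using \<A>(1) finE by (intro card_mono) auto
  also have "\<dots> \<le> (\<Sum>A\<in>\<A>. card (E A))" by (rule card_UN_le[OF \<A>(1)])
  also have "\<dots> \<le> (\<Sum>A\<in>\<A>. card \<U> ^ (k - r))"
    using pos by (intro sum_mono) (auto simp: \<A>_def cardE intro!: power_increasing)
  also have "\<dots> \<le> 2 ^ k * card \<U> ^ (k - r)" using \<A>(2) by simp
  finally show ?thesis .
qed

text \<open>A function correlated with the character sums of all tuples of a set \<open>B\<close> is, by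
  Cauchy-Schwarz, bounded by the norm of their total, i.e. by the total pairwise agreement
  over \<open>B\<close>. So the average agreement is at least \<open>256 / 2025 * k\<close>, whereas tuples outside a small
  Hamming ball agree in at most \<open>k / 20\<close> places.\<close>

lemma card_agreeing_majorities:
  fixes h :: "(nat \<Rightarrow> int) \<Rightarrow> int"
  assumes "0 < k" "k \<le> N" and \<U>: "\<U> \<subseteq> Pow {k..<N}" and r: "20 * r \<le> k + 20" "r \<le> k"
    and h: "h \<in> sign_cube N \<rightarrow> {-1, 1}"
  shows "card {U \<in> {..<k} \<rightarrow>\<^sub>E \<U>. 99 / 100 * 2 ^ N
      < real (card {x \<in> sign_cube N. h x = character_majority k U x})}
    \<le> 14 * (2 ^ k * card \<U> ^ (k - r))" (is "card ?B \<le> _")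
proof -
  have fin\<U>: "finite \<U>" using \<U> by (rule finite_subset) simp
  have finB: "finite ?B" using fin\<U> by (simp add: finite_PiE)
  have sub: "U i \<subseteq> {k..<N}" if "U \<in> ?B" "i < k" for U i
    using that \<U> by (auto simp: PiE_def Pi_def)
  define T where "T = 2 ^ k * card \<U> ^ (k - r)"
  \<comment> \<open>Tuples agreeing with \<open>U\<close> in fewer than \<open>r\<close> places
    agree in at most \<open>k / 20\<close>, by \<open>20 * r \<le> k + 20\<close>; the rest lie in a
    Hamming ball and get the trivial bound \<open>k\<close>.\<close>
  have row: "(\<Sum>V\<in>?B. real (agreement k U V)) \<le> real k / 20 * real (card ?B) + real k * real T"
    if U: "U \<in> ?B" for U
  proof -
    let ?L = "{V \<in> ?B. r \<le> agreement k U V}"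
    have le: "agreement k U V \<le> k" for V
      unfolding agreement_def by (rule order_trans[OF card_mono[of "{..<k}"]]) auto
    have "card ?L \<le> card {V \<in> {..<k} \<rightarrow>\<^sub>E \<U>. r \<le> agreement k U V}"
      using fin\<U> by (intro card_mono) (auto simp: finite_PiE)
    also have "\<dots> \<le> T"
      unfolding T_def using U by (intro card_agreement_ball fin\<U> r) auto
    finally have L: "card ?L \<le> T" .
    have "(\<Sum>V\<in>?B. real (agreement k U V)) \<le> (\<Sum>V\<in>?B. real k / 20 + (if V \<in> ?L then real k else 0))"
    proof (intro sum_mono)
      fix V assume "V \<in> ?B"
      show "real (agreement k U V) \<le> real k / 20 + (if V \<in> ?L then real k else 0)"
      proof (cases "r \<le> agreement k U V")
        case True
        then show ?thesis using \<open>V \<in> ?B\<close> le[of V] by (simp add: add_increasing)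
      next
        case False
        then have "20 * agreement k U V \<le> k" using r(1) by linarith
        then show ?thesis using False by simp
      qed
    qed
    also have "\<dots> = real k / 20 * real (card ?B) + real k * real (card ?L)"
      using finB by (simp add: sum.distrib sum.If_cases Int_def conj_commute)
    also have "\<dots> \<le> real k / 20 * real (card ?B) + real k * real T"
      using L by (intro add_left_mono mult_left_mono) auto
    finally show ?thesis .
  qed
  define S where "S = (\<Sum>x\<in>sign_cube N. real_of_int (h x) * (\<Sum>U\<in>?B. real_of_int (character_sum k U x)))"
  have "real (card ?B) * (16 / 45 * sqrt k * 2 ^ N)
      \<le> (\<Sum>U\<in>?B. \<Sum>x\<in>sign_cube N. real_of_int (h x * character_sum k U x))"
    using assms(1,2) h sub
    by (intro sum_bounded_below agreeing_function_correlation) auto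
  also have "\<dots> = S"
    unfolding S_def by (subst sum.swap) (simp add: sum_distrib_left)
  finally have "(real (card ?B) * (16 / 45 * sqrt k * 2 ^ N))\<^sup>2 \<le> S\<^sup>2"
    by (intro power_mono) auto
  also have "S\<^sup>2 \<le> (\<Sum>x\<in>sign_cube N. (real_of_int (h x))\<^sup>2)
      * (\<Sum>x\<in>sign_cube N. (\<Sum>U\<in>?B. real_of_int (character_sum k U x))\<^sup>2)"
    unfolding S_def by (rule Cauchy_Schwarz_ineq_sum)
  also have "(\<Sum>x\<in>sign_cube N. (real_of_int (h x))\<^sup>2) = (\<Sum>x\<in>sign_cube N. 1)"
    using h by (intro sum.cong refl) (auto simp: Pi_def power2_eq_1_iff)
  also have "\<dots> = 2 ^ N" by (simp add: card_sign_cube)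
  also have "(\<Sum>x\<in>sign_cube N. (\<Sum>U\<in>?B. real_of_int (character_sum k U x))\<^sup>2)
      = (\<Sum>x\<in>sign_cube N. \<Sum>U\<in>?B. \<Sum>V\<in>?B. real_of_int (character_sum k U x * character_sum k V x))"
    by (simp add: power2_eq_square sum_product)
  also have "\<dots> = (\<Sum>U\<in>?B. \<Sum>V\<in>?B. \<Sum>x\<in>sign_cube N. real_of_int (character_sum k U x * character_sum k V x))"
    by (subst sum.swap) (intro sum.cong refl sum.swap)
  also have "\<dots> = (\<Sum>U\<in>?B. \<Sum>V\<in>?B. real (agreement k U V) * 2 ^ N)"
    by (intro sum.cong refl sum_character_sum_mult assms(2) sub)
  also have "\<dots> = (\<Sum>U\<in>?B. \<Sum>V\<in>?B. real (agreement k U V)) * 2 ^ N"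
    by (simp only: sum_distrib_right)
  also have "2 ^ N * ((\<Sum>U\<in>?B. \<Sum>V\<in>?B. real (agreement k U V)) * 2 ^ N)
      \<le> 2 ^ N * (real (card ?B) * (real k / 20 * real (card ?B) + real k * real T) * 2 ^ N)"
    by (intro mult_left_mono mult_right_mono sum_bounded_above row) auto
  finally have *: "(real (card ?B) * (16 / 45 * sqrt k * 2 ^ N))\<^sup>2
      \<le> 2 ^ N * (real (card ?B) * (real k / 20 * real (card ?B) + real k * real T) * 2 ^ N)" .
  define b where "b = real (card ?B)"
  define P where "P = b * real k * (2 ^ N * 2 ^ N)"
  \<comment> \<open>Here \<open>256 / 2025 = (16 / 45)\<^sup>2\<close>. Cancelling \<open>P\<close>
    leaves \<open>(256 / 2025 - 1 / 20) * b \<le> T\<close>, and this coefficient exceeds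
    \<open>1 / 14\<close>.\<close>
  have "P * (256 / 2025 * b) \<le> P * (b / 20 + real T)"
    using * unfolding b_def[symmetric] P_def power_mult_distrib real_sqrt_pow2[OF of_nat_0_le_iff]
    by (simp add: power2_eq_square algebra_simps)
  then have "real (card ?B) \<le> real (14 * T)"
  proof (cases "b = 0")
    case False
    then have "P > 0" using assms(1) unfolding P_def b_def by (intro mult_pos_pos) auto
    with \<open>P * _ \<le> _\<close> have "256 / 2025 * b \<le> b / 20 + real T" by (simp only: mult_le_cancel_left_pos)
    moreover have "b \<ge> 0" by (simp add: b_def)
    ultimately show ?thesis unfolding b_def[symmetric] by simp
  qed (simp add: b_def)
  then show ?thesis unfolding T_def by linarith
qed

subsection \<open>Correlation under dense distributions\<close>

text \<open>The bound \<open>4 ^ n / sqrt (2 * n + 1)\<close>, squared to stay in the naturals. One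
  step multiplies the left side by \<open>4 * (2 * n + 1) * (2 * n + 3) / (n + 1)\<^sup>2\<close>,
  which is below 16 because
  \<open>(2 * n + 1) * (2 * n + 3) = 4 * (n + 1)\<^sup>2 - 1\<close>.\<close>

lemma central_binomial_sq_le: "((2 * n) choose n) ^ 2 * (2 * n + 1) \<le> 16 ^ n"
proof (induction n)
  case (Suc n)
  define b where "b = (2 * n) choose n"
  define b' where "b' = (2 * Suc n) choose (Suc n)"
  have "Suc (2 * n) choose n = Suc (2 * n) choose Suc n"
    by (subst binomial_symmetric) auto
  then have "b' = 2 * (Suc (2 * n) choose n)" by (simp add: b'_def)
  moreover have "Suc n * (Suc (2 * n) choose Suc n) = Suc (2 * n) * b"
    unfolding b_def by (rule Suc_times_binomial)
  ultimately have "Suc n * b' = 2 * (Suc (2 * n) * b)"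
    using \<open>Suc (2 * n) choose n = _\<close> by (metis mult.left_commute)
  then have rec: "Suc n * b' = 2 * (2 * n + 1) * b" by simp
  have "(Suc n) ^ 2 * (b' ^ 2 * (2 * Suc n + 1)) = (Suc n * b') ^ 2 * (2 * n + 3)"
    unfolding power_mult_distrib by (simp add: distrib_left)
  also have "\<dots> = 4 * (2 * n + 1) * (2 * n + 3) * (b ^ 2 * (2 * n + 1))"
    unfolding rec by (simp add: power2_eq_square algebra_simps)
  also have "\<dots> \<le> 16 * (Suc n) ^ 2 * (b ^ 2 * (2 * n + 1))"
    by (intro mult_right_mono) (auto simp: power2_eq_square algebra_simps)
  also have "\<dots> \<le> 16 * (Suc n) ^ 2 * 16 ^ n"
    using Suc by (intro mult_left_mono) (auto simp: b_def)
  finally have "(Suc n) ^ 2 * (b' ^ 2 * (2 * Suc n + 1)) \<le> (Suc n) ^ 2 * 16 ^ Suc n"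
    by (simp add: algebra_simps)
  then show ?case unfolding b'_def by (simp only: mult_le_cancel1) simp
qed simp

text \<open>For \<open>k = 2 * n + 1\<close> the largest coefficient is half the central one of row
  \<open>k + 1\<close>, so the central bound at \<open>n + 1\<close> applies.\<close>

lemma binomial_odd_le:
  assumes "odd k"
  shows "real (k choose j) * sqrt k \<le> 2 ^ k"
proof -
  obtain n where k: "k = 2 * n + 1" using assms by (elim oddE)
  have "k choose j \<le> k choose n" using binomial_maximum[of k j] by (simp add: k)
  moreover have "2 * (k choose n) = (2 * Suc n) choose (Suc n)"
  proof -
    have "Suc (2 * n) choose n = Suc (2 * n) choose Suc n"
      by (subst binomial_symmetric) auto
    then show ?thesis by (simp add: k)
  qed
  ultimately have "2 * (k choose j) \<le> (2 * Suc n) choose (Suc n)" by linarith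
  then have "(2 * (k choose j)) ^ 2 * k \<le> ((2 * Suc n) choose (Suc n)) ^ 2 * (2 * Suc n + 1)"
    by (intro mult_mono power_mono) (auto simp: k)
  also have "\<dots> \<le> 16 ^ Suc n" by (rule central_binomial_sq_le)
  also have "(16::nat) ^ Suc n = (2 ^ (k + 1)) ^ 2"
    unfolding k by (simp add: power2_eq_square flip: power_mult_distrib power_mult)
       (simp add: power_mult)
  finally have "real ((2 * (k choose j)) ^ 2 * k) \<le> real ((2 ^ (k + 1)) ^ 2)"
    by (simp only: of_nat_le_iff)
  then have "(2 * real (k choose j) * sqrt k) ^ 2 \<le> (2 ^ (k + 1)) ^ 2"
    by (simp add: power_mult_distrib)
  then have "2 * real (k choose j) * sqrt k \<le> 2 ^ (k + 1)"
    by (rule power2_le_imp_le) simp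
  then show ?thesis by simp
qed

lemma sum_signs:
  assumes "finite A" and "\<And>i. i \<in> A \<Longrightarrow> f i = -1 \<or> f i = (1::int)"
  shows "(\<Sum>i\<in>A. f i) = 2 * int (card {i \<in> A. f i = 1}) - int (card A)"
proof -
  have "(\<Sum>i\<in>A. f i) = (\<Sum>i\<in>A. 2 * (if f i = 1 then 1 else 0) - 1)"
    using assms(2) by (intro sum.cong) auto
  also have "\<dots> = 2 * (\<Sum>i\<in>A. if f i = 1 then 1 else 0) - int (card A)"
    by (simp add: sum_subtractf flip: sum_distrib_left)
  also have "(\<Sum>i\<in>A. if f i = 1 then 1 else 0) = int (card {i \<in> A. f i = 1})"
    using assms(1) by (simp add: sum.If_cases Int_def)
  finally show ?thesis .
qed

text \<open>Given the bits from \<open>k\<close> on, each private bit is determined by its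
  character. So a point is encoded by those bits and the set of characters equal to 1, whose size is
  fixed by \<open>v\<close>.\<close>

lemma card_character_sum_eq:
  assumes "k \<le> N" and U: "\<And>i. i < k \<Longrightarrow> U i \<subseteq> {k..<N}" and "odd k"
  shows "real (card {x \<in> sign_cube N. character_sum k U x = v}) * sqrt k \<le> 2 ^ N"
proof -
  let ?L = "{x \<in> sign_cube N. character_sum k U x = v}"
  define pos where "pos x = {i \<in> {..<k}. character (insert i (U i)) x = 1}" for x
  \<comment> \<open>Solves \<open>v = 2 * card (pos x) - k\<close>. If \<open>v\<close> is not
    attained, \<open>?L\<close> is empty and \<open>j\<close> is arbitrary.\<close>
  define j where "j = nat ((v + int k) div 2)"
  let ?R = "{A. A \<subseteq> {..<k} \<and> card A = j} \<times> ({k..<N} \<rightarrow>\<^sub>E {-1, 1 :: int})"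
  have sub: "insert i (U i) \<subseteq> {..<N}" if "i < k" for i
    using U[OF that] that assms(1) by auto
  have val: "character (insert i (U i)) x = -1 \<or> character (insert i (U i)) x = 1"
    if "x \<in> sign_cube N" "i < k" for x i
    using character_values[OF that(1) sub[OF that(2)]] .
  have ch: "character (insert i (U i)) x = x i * character (U i) x" if "i < k" for i x
    using U[OF that] finite_subset[of "U i" "{k..<N}"] that
    unfolding character_def by (subst prod.insert) auto
  have inj: "inj_on (\<lambda>x. (pos x, restrict x {k..<N})) ?L"
  proof (rule inj_onI)
    fix x y assume x: "x \<in> ?L" and y: "y \<in> ?L"
      and "(pos x, restrict x {k..<N}) = (pos y, restrict y {k..<N})"
    then have p: "pos x = pos y" and r: "\<And>t. t \<in> {k..<N} \<Longrightarrow> x t = y t"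
      by (auto dest: fun_cong simp: restrict_def split: if_splits)
    have "x t = y t" if "t < N" for t
    proof (cases "t < k")
      case True
      have "character (insert t (U t)) x = 1 \<longleftrightarrow> character (insert t (U t)) y = 1"
        using p True by (auto simp: pos_def)
      then have "character (insert t (U t)) x = character (insert t (U t)) y"
        using val[of x t] val[of y t] x y True by auto
      moreover have "character (U t) x = character (U t) y"
        unfolding character_def using U[OF True] by (intro prod.cong refl r) auto
      moreover have "character (U t) y \<noteq> 0"
        using character_values[of y N "U t"] y sub[OF True] by auto
      ultimately show ?thesis by (simp add: ch[OF True])
    qed (use that r in auto)
    then show "x = y" using x y
      by (intro extensionalityI[of _ "{..<N}"]) (auto simp: sign_cube_def PiE_def)
  qed
  have img: "(\<lambda>x. (pos x, restrict x {k..<N})) ` ?L \<subseteq> ?R"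
  proof (intro image_subsetI)
    fix x assume x: "x \<in> ?L"
    have "v = 2 * int (card (pos x)) - int k"
      using x sum_signs[of "{..<k}" "\<lambda>i. character (insert i (U i)) x"] val[of x]
      by (auto simp: character_sum_def pos_def)
    then have "card (pos x) = j" by (simp add: j_def)
    moreover have "restrict x {k..<N} \<in> {k..<N} \<rightarrow>\<^sub>E {-1, 1}"
      using x by (auto simp: sign_cube_def PiE_def Pi_def)
    ultimately show "(pos x, restrict x {k..<N}) \<in> ?R" by (auto simp: pos_def)
  qed
  have "card ?L \<le> card ?R"
    by (rule card_inj_on_le[OF inj img]) (auto intro!: finite_PiE)
  also have "\<dots> = (k choose j) * 2 ^ (N - k)"
    by (simp add: card_cartesian_product n_subsets card_PiE numeral_2_eq_2)
  finally have "real (card ?L) * sqrt k \<le> real ((k choose j) * 2 ^ (N - k)) * sqrt k"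
    by (intro mult_right_mono) (simp_all only: of_nat_le_iff real_sqrt_ge_zero of_nat_0_le_iff)
  also have "\<dots> = (real (k choose j) * sqrt k) * 2 ^ (N - k)" by simp
  also have "\<dots> \<le> 2 ^ k * 2 ^ (N - k)"
    using binomial_odd_le[OF assms(3)] by (intro mult_right_mono) auto
  also have "\<dots> = (2 ^ N :: real)" using assms(1) by (simp flip: power_add)
  finally show ?thesis .
qed

lemma card_character_sum_small:
  assumes "k \<le> N" and U: "\<And>i. i < k \<Longrightarrow> U i \<subseteq> {k..<N}" and "odd k"
  shows "real (card {x \<in> sign_cube N. \<bar>character_sum k U x\<bar> \<le> int m}) * sqrt k
    \<le> (2 * real m + 1) * 2 ^ N"
proof -
  let ?L = "\<lambda>v. {x \<in> sign_cube N. character_sum k U x = v}"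
  have "{x \<in> sign_cube N. \<bar>character_sum k U x\<bar> \<le> int m} = (\<Union>v\<in>{- int m..int m}. ?L v)"
    by auto
  then have "card {x \<in> sign_cube N. \<bar>character_sum k U x\<bar> \<le> int m} \<le> (\<Sum>v\<in>{- int m..int m}. card (?L v))"
    by (simp add: card_UN_le)
  then have "real (card {x \<in> sign_cube N. \<bar>character_sum k U x\<bar> \<le> int m}) * sqrt k
      \<le> real (\<Sum>v\<in>{- int m..int m}. card (?L v)) * sqrt k"
    by (intro mult_right_mono) (simp_all only: of_nat_le_iff real_sqrt_ge_zero of_nat_0_le_iff)
  also have "\<dots> = (\<Sum>v\<in>{- int m..int m}. real (card (?L v)) * sqrt k)"
    by (simp add: sum_distrib_right)
  also have "\<dots> \<le> (\<Sum>v\<in>{- int m..int m}. 2 ^ N)"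
    by (intro sum_mono card_character_sum_eq assms)
  also have "\<dots> = (2 * real m + 1) * 2 ^ N" by (simp add: algebra_simps)
  finally show ?thesis .
qed

text \<open>If \<open>c * sqrt k < 4\<close> then oddness of \<open>k\<close> alone suffices, since the character sum
  never vanishes; otherwise, by the point mass bound, \<open>H\<close> gives mass at most \<open>1 / 2\<close> to the
  points where the character sum is at most \<open>c * sqrt k / 8\<close>.\<close>

lemma dense_expectation_abs_character_sum:
  assumes "k \<le> N" and U: "\<And>i. i < k \<Longrightarrow> U i \<subseteq> {k..<N}" and "odd k"
    and "0 < c" and H: "has_density H (sign_cube N) c"
  shows "c * sqrt k / 16 \<le> (\<Sum>x\<in>sign_cube N. pmf H x * real_of_int \<bar>character_sum k U x\<bar>)"
proof -
  have total: "(\<Sum>x\<in>sign_cube N. pmf H x) = 1"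
    using H by (intro sum_pmf_eq_1) (auto simp: has_density_def)
  have kpos: "sqrt k > 0" using assms(3) by (auto intro: Nat.gr0I)
  show ?thesis
  proof (cases "c * sqrt k < 4")
    case True
    have nz: "1 \<le> \<bar>character_sum k U x\<bar>" if "x \<in> sign_cube N" for x
    proof -
      have "character_sum k U x
          = 2 * int (card {i \<in> {..<k}. character (insert i (U i)) x = 1}) - int (card {..<k})"
        unfolding character_sum_def
        using U assms(1) by (intro sum_signs character_values[OF that]) fastforce+
      then show ?thesis using assms(3) by (cases "character_sum k U x = 0") (simp, presburger, linarith)
    qed
    have "c * sqrt k / 16 \<le> (\<Sum>x\<in>sign_cube N. pmf H x * 1)" using True total by simp
    also have "\<dots> \<le> (\<Sum>x\<in>sign_cube N. pmf H x * real_of_int \<bar>character_sum k U x\<bar>)"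
      using nz by (intro sum_mono mult_left_mono) (auto simp del: of_int_abs)
    finally show ?thesis .
  next
    case False
    define m where "m = nat \<lfloor>c * sqrt k / 8\<rfloor>"
    have m: "real m \<le> c * sqrt k / 8" "c * sqrt k / 8 < real m + 1"
      using assms(4) kpos unfolding m_def by (subst of_nat_nat; simp; linarith)+
    let ?L = "{x \<in> sign_cube N. \<bar>character_sum k U x\<bar> \<le> int m}"
    have "real (card ?L) * sqrt k \<le> (2 * real m + 1) * 2 ^ N"
      by (rule card_character_sum_small[OF assms(1) U assms(3)])
    \<comment> \<open>Here \<open>2 * m \<le> c * sqrt k / 4\<close>, and in this case also
      \<open>1 \<le> c * sqrt k / 4\<close>.\<close>
    also have "\<dots> \<le> (c * sqrt k / 2) * 2 ^ N"
      using m False by (intro mult_right_mono) auto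
    finally have L: "real (card ?L) \<le> c / 2 * 2 ^ N"
      using kpos by (simp add: mult_ac)
    have "(\<Sum>x\<in>?L. pmf H x) \<le> (\<Sum>x\<in>?L. 1 / (c * 2 ^ N))"
      using H by (intro sum_mono) (auto simp: has_density_def card_sign_cube)
    also have "\<dots> = real (card ?L) * (1 / (c * 2 ^ N))" by simp
    also have "\<dots> \<le> c / 2 * 2 ^ N * (1 / (c * 2 ^ N))"
      using L assms(4) by (intro mult_right_mono) auto
    also have "\<dots> = 1 / 2" using assms(4) by simp
    finally have half: "(\<Sum>x\<in>?L. pmf H x) \<le> 1 / 2" .
    have "(\<Sum>x\<in>sign_cube N. pmf H x) = (\<Sum>x\<in>?L. pmf H x) + (\<Sum>x\<in>sign_cube N - ?L. pmf H x)"
      by (subst sum.subset_diff[of ?L]) auto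
    then have "1 / 2 \<le> (\<Sum>x\<in>sign_cube N - ?L. pmf H x)" using total half by simp
    then have "c * sqrt k / 16 \<le> c * sqrt k / 8 * (\<Sum>x\<in>sign_cube N - ?L. pmf H x)"
      using assms(4) kpos by simp
    also have "\<dots> = (\<Sum>x\<in>sign_cube N - ?L. pmf H x * (c * sqrt k / 8))"
      by (simp add: sum_distrib_left mult_ac)
    also have "\<dots> \<le> (\<Sum>x\<in>sign_cube N - ?L. pmf H x * real_of_int \<bar>character_sum k U x\<bar>)"
    proof (intro sum_mono mult_left_mono)
      fix x assume "x \<in> sign_cube N - ?L"
      then have "int m + 1 \<le> \<bar>character_sum k U x\<bar>" by auto
      then have "real m + 1 \<le> real_of_int \<bar>character_sum k U x\<bar>"
        by (metis of_int_le_iff of_int_add of_int_1 of_int_of_nat_eq)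
      then show "c * sqrt k / 8 \<le> real_of_int \<bar>character_sum k U x\<bar>" using m(2) by linarith
    qed auto
    also have "\<dots> \<le> (\<Sum>x\<in>sign_cube N. pmf H x * real_of_int \<bar>character_sum k U x\<bar>)"
      by (intro sum_mono2) auto
    finally show ?thesis .
  qed
qed

text \<open>Averaging: the mean absolute character sum is the total of the advantages
  \<open>2 * p i - 1\<close>, so not all \<open>k\<close> of them can be below
  \<open>c / (16 * sqrt k)\<close>.\<close>

lemma exists_correlated_character:
  assumes "k \<le> N" and U: "\<And>i. i < k \<Longrightarrow> U i \<subseteq> {k..<N}" and "odd k"
    and "0 < c" and H: "has_density H (sign_cube N) c"
  shows "\<exists>i<k. 1 / 2 + c / (32 * sqrt k)
    \<le> measure_pmf.prob H {x \<in> sign_cube N. character (insert i (U i)) x = character_majority k U x}"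
proof (rule ccontr)
  define p where "p i = measure_pmf.prob H {x \<in> sign_cube N. character (insert i (U i)) x = character_majority k U x}" for i
  assume "\<not> ?thesis"
  then have small: "p i < 1 / 2 + c / (32 * sqrt k)" if "i < k" for i
    using that by (auto simp: p_def not_le)
  have kpos: "k > 0" using assms(3) by (auto intro: Nat.gr0I)
  have total: "(\<Sum>x\<in>sign_cube N. pmf H x) = 1"
    using H by (intro sum_pmf_eq_1) (auto simp: has_density_def)
  have p: "(\<Sum>x\<in>sign_cube N. pmf H x * real_of_int (character_majority k U x * character (insert i (U i)) x))
      = 2 * p i - 1" if "i < k" for i
  proof -
    let ?A = "{x \<in> sign_cube N. character (insert i (U i)) x = character_majority k U x}"
    have sub: "insert i (U i) \<subseteq> {..<N}" using U[OF that] that assms(1) by auto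
    have "(\<Sum>x\<in>sign_cube N. pmf H x * real_of_int (character_majority k U x * character (insert i (U i)) x))
      = (\<Sum>x\<in>sign_cube N. 2 * (if x \<in> ?A then pmf H x else 0) - pmf H x)"
    proof (intro sum.cong refl)
      fix x assume "x \<in> sign_cube N"
      then show "pmf H x * real_of_int (character_majority k U x * character (insert i (U i)) x)
          = 2 * (if x \<in> ?A then pmf H x else 0) - pmf H x"
        using character_values[of x N, OF _ sub] by (auto simp: character_majority_def)
    qed
    also have "\<dots> = 2 * (\<Sum>x\<in>?A. pmf H x) - 1"
      by (simp add: sum_subtractf total sum.If_cases Int_def conj_commute flip: sum_distrib_left)
    finally show ?thesis by (simp add: p_def measure_measure_pmf_finite)
  qed
  have "c * sqrt k / 16 \<le> (\<Sum>x\<in>sign_cube N. pmf H x * real_of_int \<bar>character_sum k U x\<bar>)"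
    by (rule dense_expectation_abs_character_sum[OF assms])
  also have "\<dots> = (\<Sum>x\<in>sign_cube N. \<Sum>i<k. pmf H x * real_of_int (character_majority k U x * character (insert i (U i)) x))"
    unfolding majority_mult_sum[symmetric] by (simp add: character_sum_def sum_distrib_left)
  also have "\<dots> = (\<Sum>i<k. 2 * p i - 1)"
    by (subst sum.swap) (intro sum.cong refl p, simp)
  also have "\<dots> < (\<Sum>i<k. 2 * (1 / 2 + c / (32 * sqrt k)) - 1)"
  proof (intro sum_strict_mono)
    fix i assume "i \<in> {..<k}"
    then show "2 * p i - 1 < 2 * (1 / 2 + c / (32 * sqrt k)) - 1"
      using mult_strict_left_mono[OF small[of i], of 2] by (simp del: distrib_left_numeral)
  qed (use kpos in auto)
  also have "\<dots> = real k * (c / (16 * sqrt k))" by simp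
  also have "\<dots> = c * sqrt k / 16" using kpos by (simp add: field_simps)
  finally show False by simp
qed

subsection \<open>Circuits for characters and the number of circuits\<close>

text \<open>Chains the xor of wire \<open>a\<close> with the wires \<open>us\<close>, where \<open>n\<close> is the number of the first
  free wire; each xor uses four gates.\<close>

fun xor_gates :: "nat \<Rightarrow> nat \<Rightarrow> nat list \<Rightarrow> gate list" where
  "xor_gates n a [] = []"
| "xor_gates n a (u # us) =
     [And a u, Or a u, Not n, And (n + 1) (n + 2)] @ xor_gates (n + 4) (n + 3) us"

fun xor_out :: "nat \<Rightarrow> nat \<Rightarrow> nat list \<Rightarrow> nat" where
  "xor_out n a [] = a"
| "xor_out n a (u # us) = xor_out (n + 4) (n + 3) us"

lemma length_xor_gates [simp]: "length (xor_gates n a us) = 4 * length us"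
  by (induction n a us rule: xor_gates.induct) auto

lemma xor_out_less: "a < n \<Longrightarrow> xor_out n a us < n + 4 * length us"
  by (induction n a us rule: xor_gates.induct) fastforce+

lemma xor_gates_args:
  "a < n \<Longrightarrow> \<forall>u\<in>set us. u < n \<Longrightarrow> i < length (xor_gates n a us) \<Longrightarrow>
    j \<in> gate_args (xor_gates n a us ! i) \<Longrightarrow> j < n + i"
proof (induction n a us arbitrary: i rule: xor_gates.induct)
  case (2 n a u us)
  show ?case
  proof (cases "i < 4")
    case True
    then have "i \<in> {0, 1, 2, 3}" by auto
    then show ?thesis using 2 by (auto simp: eval_nat_numeral)
  next
    case False
    then obtain i' where i: "i = i' + 4" by (metis add.commute le_add_diff_inverse not_less)
    have "j < (n + 4) + i'"
      using 2 by (intro "2.IH") (auto simp: i eval_nat_numeral)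
    then show ?thesis by (simp add: i)
  qed
qed simp

text \<open>With True as -1, xor is multiplication of signs; the left side is the formula that the
  four gates evaluate.\<close>

lemma sign_of_bool_xor: "sign_of_bool ((p \<or> q) \<and> \<not> (p \<and> q)) = sign_of_bool p * sign_of_bool q"
  by (auto simp: sign_of_bool_def)

text \<open>The induction varies \<open>ws\<close>, since each round appends four wires: the running
  xor moves to the last of them, \<open>n + 3\<close>, and the old wires keep their values.\<close>

lemma wire_vals_xor_gates:
  "length ws = n \<Longrightarrow> a < n \<Longrightarrow> \<forall>u\<in>set us. u < n \<Longrightarrow>
    sign_of_bool (wire_vals (xor_gates n a us) ws ! xor_out n a us)
      = sign_of_bool (ws ! a) * (\<Prod>u\<leftarrow>us. sign_of_bool (ws ! u))"
proof (induction n a us arbitrary: ws rule: xor_gates.induct)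
  case (2 n a u us)
  define p where "p = ws ! a"
  define q where "q = ws ! u"
  define ws' where "ws' = ws @ [p \<and> q, p \<or> q, \<not> (p \<and> q), (p \<or> q) \<and> \<not> (p \<and> q)]"
  have len: "length ws' = n + 4" using 2 by (simp add: ws'_def)
  have step: "wire_vals (xor_gates n a (u # us)) ws = wire_vals (xor_gates (n + 4) (n + 3) us) ws'"
    using 2(2-4) by (simp add: wire_vals_def ws'_def p_def q_def nth_append)
  have old: "ws' ! v = ws ! v" if "v < n" for v using that 2(2) by (simp add: ws'_def nth_append)
  have new: "ws' ! (n + 3) \<longleftrightarrow> (p \<or> q) \<and> \<not> (p \<and> q)" using 2(2) by (simp add: ws'_def nth_append)
  have "sign_of_bool (wire_vals (xor_gates n a (u # us)) ws ! xor_out n a (u # us))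
      = sign_of_bool (ws' ! (n + 3)) * (\<Prod>v\<leftarrow>us. sign_of_bool (ws' ! v))"
    unfolding step xor_out.simps using 2(4) by (intro "2.IH" len) auto
  also have "(\<Prod>v\<leftarrow>us. sign_of_bool (ws' ! v)) = (\<Prod>v\<leftarrow>us. sign_of_bool (ws ! v))"
    using 2(4) by (intro arg_cong[where f = prod_list] map_cong refl) (simp add: old)
  finally show ?case unfolding new sign_of_bool_xor by (simp add: p_def q_def mult.assoc)
qed (simp add: wire_vals_def)

lemma character_circuit:
  assumes "i < N" "V \<subseteq> {..<N}" "i \<notin> V"
  shows "\<exists>C. wf_circuit N C \<and> circuit_size C = 4 * card V \<and>
    (\<forall>x\<in>sign_cube N. circuit_fun N C x = character (insert i V) x)"
proof -
  have fin: "finite V" using assms(2) by (rule finite_subset) simp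
  define us where "us = sorted_list_of_set V"
  have us: "set us = V" "distinct us" "length us = card V" using fin by (auto simp: us_def)
  then have lt: "\<forall>u\<in>set us. u < N" using assms(2) by auto
  define C where "C = Circuit (xor_gates N i us) (xor_out N i us)"
  have "wf_circuit N C"
    using xor_gates_args[OF assms(1) lt] xor_out_less[OF assms(1), of us]
    by (auto simp: wf_circuit_def C_def)
  moreover have "circuit_size C = 4 * card V" by (simp add: circuit_size_def C_def us)
  moreover have "circuit_fun N C x = character (insert i V) x" if x: "x \<in> sign_cube N" for x
  proof -
    let ?ws = "map (\<lambda>i. bool_of_sign (x i)) [0..<N]"
    have ws: "sign_of_bool (?ws ! t) = x t" if "t < N" for t
      using sign_cube_values[OF x that] that by (auto simp: sign_of_bool_def bool_of_sign_def)
    have "circuit_fun N C x = sign_of_bool (?ws ! i) * (\<Prod>u\<leftarrow>us. sign_of_bool (?ws ! u))"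
      unfolding circuit_fun_def C_def circuit.sel
      by (rule wire_vals_xor_gates) (use assms(1) lt in auto)
    also have "(\<Prod>u\<leftarrow>us. sign_of_bool (?ws ! u)) = (\<Prod>u\<leftarrow>us. x u)"
      using lt by (intro arg_cong[where f = prod_list] map_cong refl ws) auto
    also have "\<dots> = (\<Prod>u\<in>V. x u)"
      using us by (metis prod.distinct_set_conv_list)
    also have "sign_of_bool (?ws ! i) = x i" by (rule ws[OF assms(1)])
    finally show ?thesis using fin assms(3) by (simp add: character_def)
  qed
  ultimately show ?thesis by blast
qed

lemma circuit_fun_values: "circuit_fun N C x \<in> {-1, 1}"
  by (simp add: circuit_fun_def sign_of_bool_def)

text \<open>With \<open>W = N + s\<close>, well-formedness keeps all wire numbers below
  \<open>W\<close>. This leaves at most \<open>2 * W\<^sup>2 + W \<le> W ^ 3\<close> gates,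
  \<open>(s + 1) * W ^ (3 * s)\<close> gate lists and \<open>W\<close> output wires.\<close>

lemma card_circuits:
  assumes "0 < N" "0 < s" "3 \<le> N + s"
  shows "finite {C. wf_circuit N C \<and> circuit_size C \<le> s}"
    and "card {C. wf_circuit N C \<and> circuit_size C \<le> s} \<le> (N + s) ^ (5 * s)"
proof -
  define W where "W = N + s"
  define P where "P = {..<W} \<times> {..<W}"
  define \<G> where "\<G> = (\<lambda>(i, j). And i j) ` P \<union> (\<lambda>(i, j). Or i j) ` P \<union> Not ` {..<W}"
  have fin\<G>: "finite \<G>" by (simp add: \<G>_def P_def)
  have "card \<G> \<le> card P + card P + W"
    unfolding \<G>_def P_def
    by (intro order_trans[OF card_Un_le] add_mono order_trans[OF card_image_le]) auto
  also have "\<dots> = W * (2 * W + 1)" by (simp add: P_def algebra_simps)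
  also have "\<dots> \<le> W * (W * W)"
  proof (intro mult_left_mono)
    have "3 * W \<le> W * W" using assms(3) unfolding W_def by (rule mult_right_mono) simp
    moreover have "2 * W + 1 \<le> 3 * W" using assms(3) by (simp add: W_def)
    ultimately show "2 * W + 1 \<le> W * W" by (rule order_trans[rotated])
  qed simp
  finally have card\<G>: "card \<G> \<le> W ^ 3" by (simp add: power3_eq_cube)
  define Ls where "Ls = {gs. set gs \<subseteq> \<G> \<and> length gs \<le> s}"
  have finL: "finite Ls" unfolding Ls_def by (rule finite_lists_length_le[OF fin\<G>])
  have "card Ls = (\<Sum>l\<le>s. card \<G> ^ l)" unfolding Ls_def by (rule card_lists_length_le[OF fin\<G>])
  also have "\<dots> \<le> (\<Sum>l\<le>s. (W ^ 3) ^ s)"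
  proof (intro sum_mono)
    fix l assume "l \<in> {..s}"
    have "card \<G> ^ l \<le> (W ^ 3) ^ l" using card\<G> by (rule power_mono) simp
    also have "\<dots> \<le> (W ^ 3) ^ s" using \<open>l \<in> _\<close> assms by (intro power_increasing) (auto simp: W_def)
    finally show "card \<G> ^ l \<le> (W ^ 3) ^ s" .
  qed
  also have "\<dots> = (s + 1) * W ^ (3 * s)" by (simp add: power_mult)
  also have "\<dots> \<le> W * W ^ (3 * s)" using assms(1) by (intro mult_right_mono) (auto simp: W_def)
  finally have cardL: "card Ls \<le> W * W ^ (3 * s)" .
  have sub: "{C. wf_circuit N C \<and> circuit_size C \<le> s} \<subseteq> (\<lambda>(gs, w). Circuit gs w) ` (Ls \<times> {..<W})"
  proof
    fix C assume C: "C \<in> {C. wf_circuit N C \<and> circuit_size C \<le> s}"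
    obtain gs w where Cd: "C = Circuit gs w" by (cases C)
    have len: "length gs \<le> s" and args: "\<And>i j. i < length gs \<Longrightarrow> j \<in> gate_args (gs ! i) \<Longrightarrow> j < N + i"
      and w: "w < N + length gs"
      using C by (auto simp: Cd wf_circuit_def circuit_size_def)
    have "gs ! i \<in> \<G>" if "i < length gs" for i
    proof -
      have "\<And>j. j \<in> gate_args (gs ! i) \<Longrightarrow> j < W"
        using args[OF that] that len by (fastforce simp: W_def)
      then show ?thesis by (cases "gs ! i") (auto simp: \<G>_def P_def)
    qed
    then have "set gs \<subseteq> \<G>" by (metis in_set_conv_nth subsetI)
    then show "C \<in> (\<lambda>(gs, w). Circuit gs w) ` (Ls \<times> {..<W})"
      using len w by (auto simp: Cd Ls_def W_def image_iff)
  qed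
  show "finite {C. wf_circuit N C \<and> circuit_size C \<le> s}"
    using finL by (intro finite_subset[OF sub]) auto
  have "card {C. wf_circuit N C \<and> circuit_size C \<le> s} \<le> card ((\<lambda>(gs, w). Circuit gs w) ` (Ls \<times> {..<W}))"
    using finL by (intro card_mono sub) auto
  also have "\<dots> \<le> card (Ls \<times> {..<W})" using finL by (intro card_image_le) auto
  also have "\<dots> \<le> W * W ^ (3 * s) * W" using cardL by (simp add: card_cartesian_product)
  also have "\<dots> = W ^ (3 * s + 2)" by (simp add: power_add power2_eq_square)
  also have "\<dots> \<le> W ^ (5 * s)" using assms by (intro power_increasing) (auto simp: W_def)
  finally show "card {C. wf_circuit N C \<and> circuit_size C \<le> s} \<le> (N + s) ^ (5 * s)"
    by (simp add: W_def)
qed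

subsection \<open>The hard majority\<close>

text \<open>If each of the \<open>D ^ k\<close> tuples were bad for some circuit, the union bound
  over circuits would give \<open>D ^ r \<le> M ^ (15 * s)\<close>. But \<open>D \<ge> M ^ B\<close>
  and \<open>20 * r > k\<close>, so the factor \<open>300 = 20 * 15\<close> in the bound on
  \<open>B\<close> rules this out.\<close>

lemma exists_hard_majority:
  assumes "0 < k" "k \<le> s" and B: "300 * s \<le> B * k" and M: "M = k + B + s + 2" and N: "N = k + B * M"
  shows "\<exists>U. (\<forall>i<k. U i \<subseteq> {k..<N} \<and> card (U i) = B) \<and>
    (\<forall>C. wf_circuit N C \<longrightarrow> circuit_size C \<le> s \<longrightarrow>
      real (card {x \<in> sign_cube N. circuit_fun N C x = character_majority k U x}) \<le> 99 / 100 * 2 ^ N)"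
proof (rule ccontr)
  assume contr: "\<not> ?thesis"
  have Bpos: "B > 0" using assms by (cases B) auto
  define \<U> where "\<U> = {A. A \<subseteq> {k..<N} \<and> card A = B}"
  define D where "D = card \<U>"
  have D: "M ^ B \<le> D"
  proof -
    have "(real (B * M) / real B) ^ B \<le> real ((B * M) choose B)"
      using M by (intro binomial_ge_n_over_k_pow_k) simp
    then have "real (M ^ B) \<le> real ((B * M) choose B)" using Bpos by simp
    then have "M ^ B \<le> (B * M) choose B" by (simp only: of_nat_le_iff)
    also have "(B * M) choose B = D" by (simp add: D_def \<U>_def n_subsets N)
    finally show ?thesis .
  qed
  have sub: "\<U> \<subseteq> Pow {k..<N}" by (auto simp: \<U>_def)
  \<comment> \<open>The least integer above \<open>k / 20\<close>:
    \<open>20 * r \<le> k + 20\<close> serves the ball count, \<open>k < 20 * r\<close> the final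
    contradiction.\<close>
  define r where "r = k div 20 + 1"
  have r: "20 * r \<le> k + 20" "k < 20 * r" "r \<le> k" using assms(1) by (auto simp: r_def)
  define \<C> where "\<C> = {C. wf_circuit N C \<and> circuit_size C \<le> s}"
  have "B * 2 \<le> B * M" by (rule mult_left_mono) (simp_all add: M)
  then have W: "0 < N" "0 < s" "3 \<le> N + s"
    using assms(1,2) Bpos unfolding N by linarith+
  define bad where "bad C = {U \<in> {..<k} \<rightarrow>\<^sub>E \<U>. 99 / 100 * 2 ^ N
      < real (card {x \<in> sign_cube N. circuit_fun N C x = character_majority k U x})}" for C
  have bad: "card (bad C) \<le> 14 * (2 ^ k * D ^ (k - r))" for C
    unfolding bad_def D_def using circuit_fun_values[of N C] assms(1)
    by (intro card_agreeing_majorities sub r) (auto simp: N)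
  have "({..<k} \<rightarrow>\<^sub>E \<U>) \<subseteq> (\<Union>C\<in>\<C>. bad C)"
  proof
    fix U assume U: "U \<in> {..<k} \<rightarrow>\<^sub>E \<U>"
    then have "\<forall>i<k. U i \<subseteq> {k..<N} \<and> card (U i) = B" by (auto simp: \<U>_def PiE_def Pi_def)
    then have "\<not> (\<forall>C. wf_circuit N C \<longrightarrow> circuit_size C \<le> s \<longrightarrow>
        real (card {x \<in> sign_cube N. circuit_fun N C x = character_majority k U x}) \<le> 99 / 100 * 2 ^ N)"
      using contr by blast
    then obtain C where "C \<in> \<C>" "\<not> real (card {x \<in> sign_cube N. circuit_fun N C x = character_majority k U x})
        \<le> 99 / 100 * 2 ^ N"
      by (auto simp only: \<C>_def mem_Collect_eq)
    then show "U \<in> (\<Union>C\<in>\<C>. bad C)"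
      using U unfolding bad_def not_le by blast
  qed
  moreover have "finite (bad C)" for C
    unfolding bad_def \<U>_def by (simp add: finite_PiE)
  ultimately have "card ({..<k} \<rightarrow>\<^sub>E \<U>) \<le> card (\<Union>C\<in>\<C>. bad C)"
    using card_circuits(1)[OF W] by (intro card_mono) (auto simp: \<C>_def)
  also have "\<dots> \<le> (\<Sum>C\<in>\<C>. card (bad C))"
    using card_circuits(1)[OF W] by (intro card_UN_le) (simp add: \<C>_def)
  also have "\<dots> \<le> card \<C> * (14 * (2 ^ k * D ^ (k - r)))"
    using bad sum_bounded_above[of \<C> "\<lambda>C. card (bad C)"] by simp
  also have "\<dots> \<le> (N + s) ^ (5 * s) * (14 * (2 ^ k * D ^ (k - r)))"
    using card_circuits(2)[OF W] by (intro mult_right_mono) (auto simp: \<C>_def)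
  finally have "D ^ k \<le> (N + s) ^ (5 * s) * (14 * 2 ^ k) * D ^ (k - r)"
    by (simp add: card_PiE D_def mult.assoc)
  moreover have "D ^ k = D ^ r * D ^ (k - r)" using r(3) by (simp flip: power_add)
  moreover have "D > 0" using D M by (metis add_gr_0 gr0I le_zero_eq power_not_zero zero_less_numeral not_gr_zero)
  ultimately have "D ^ r \<le> (N + s) ^ (5 * s) * (14 * 2 ^ k)" by simp
  \<comment> \<open>Everything is compared in base \<open>M\<close>: it exceeds
    \<open>1 + B\<close>, so \<open>N + s \<le> M\<^sup>2\<close>, and it is at least 2, which
    absorbs \<open>14\<close> and \<open>2 ^ k\<close>.\<close>
  also have "\<dots> \<le> M ^ (10 * s) * (M ^ 4 * M ^ k)"
  proof (intro mult_mono)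
    have "N + s \<le> (1 + B) * M" using M by (simp add: N)
    also have "\<dots> \<le> M * M" by (rule mult_right_mono) (simp_all add: M)
    also have "\<dots> = M ^ 2" by (simp add: power2_eq_square)
    finally have "(N + s) ^ (5 * s) \<le> (M ^ 2) ^ (5 * s)" by (rule power_mono) simp
    then show "(N + s) ^ (5 * s) \<le> M ^ (10 * s)" by (simp flip: power_mult)
    have "(2::nat) ^ 4 \<le> M ^ 4" by (rule power_mono) (auto simp: M)
    then show "14 \<le> M ^ 4" by simp
    show "2 ^ k \<le> M ^ k" by (rule power_mono) (auto simp: M)
  qed auto
  also have "\<dots> = M ^ (10 * s + 4 + k)" by (simp add: power_add)
  also have "\<dots> \<le> M ^ (15 * s)" using assms(1,2) by (intro power_increasing) (auto simp: M)
  finally have "D ^ r \<le> M ^ (15 * s)" .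
  moreover have "M ^ (B * r) \<le> D ^ r" using power_mono[OF D, of r] by (simp add: power_mult)
  ultimately have "M ^ (B * r) \<le> M ^ (15 * s)" by linarith
  then have "B * r \<le> 15 * s" using M by (subst (asm) power_increasing_iff) auto
  moreover have "B * k < B * (20 * r)" using r(2) Bpos by simp
  ultimately show False using B by simp
qed

text \<open>The upper bounds on \<open>k\<close> give advantage \<open>\<gamma>\<close> and
  \<open>k \<le> s\<close>; the lower bound keeps \<open>B\<close>, of order \<open>s / k\<close>,
  within order \<open>s * \<gamma>\<^sup>2\<close>. The alternative \<open>k = 1\<close> covers
  \<open>\<gamma>\<close> too large for \<open>c\<close>: there the majority is a single
  character.\<close>

lemma exists_majority_size:
  fixes c \<gamma> :: real
  assumes "0 < c" "c \<le> 1" "0 < \<gamma>" "\<gamma> \<le> 1 / 2"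
  shows "\<exists>k. odd k \<and> (k = 1 \<or> \<gamma> \<le> c / (32 * sqrt k)) \<and>
    real k \<le> 1 / \<gamma>\<^sup>2 \<and> c\<^sup>2 / (3072 * \<gamma>\<^sup>2) \<le> real k"
proof -
  \<comment> \<open>The inequality \<open>\<gamma> \<le> c / (32 * sqrt k)\<close> amounts to
    \<open>k \<le> y\<close>.\<close>
  define y where "y = c\<^sup>2 / (1024 * \<gamma>\<^sup>2)"
  have y: "0 < y" using assms by (simp add: y_def)
  define n where "n = nat \<lfloor>y\<rfloor>"
  have n: "real n \<le> y" "y < real n + 1"
    using y unfolding n_def by (subst of_nat_nat; simp; linarith)+
  \<comment> \<open>The largest odd number up to \<open>n\<close>; at \<open>n = 0\<close> truncated
    subtraction makes it 1. The bound \<open>n + 1 \<le> 3 * k\<close> is tight at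
    \<open>n = 2\<close> and turns 1024 into 3072.\<close>
  define k where "k = 2 * ((n - 1) div 2) + 1"
  have k: "odd k" "k = 1 \<or> k \<le> n" "n + 1 \<le> 3 * k" by (auto simp: k_def)
  have "c\<^sup>2 \<le> 1" using assms by (simp add: power_le_one)
  have one: "1 \<le> 1 / \<gamma>\<^sup>2" using assms by (simp add: power_le_one)
  have "y \<le> 1 / \<gamma>\<^sup>2" using assms \<open>c\<^sup>2 \<le> 1\<close> by (simp add: y_def field_simps)
  then have "real k \<le> 1 / \<gamma>\<^sup>2" using k(2) n(1) one by auto
  moreover have "c\<^sup>2 / (3072 * \<gamma>\<^sup>2) \<le> real k"
  proof -
    have "c\<^sup>2 / (3072 * \<gamma>\<^sup>2) = y / 3" by (simp add: y_def)
    also have "\<dots> \<le> real (n + 1) / 3" using n(2) by simp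
    also have "\<dots> \<le> real (3 * k) / 3" using k(3) by simp
    finally show ?thesis by simp
  qed
  moreover have "\<gamma> \<le> c / (32 * sqrt k)" if "k \<noteq> 1"
  proof -
    have "real k \<le> y" using that k(2) n(1) by auto
    then have "sqrt k \<le> sqrt y" by simp
    also have "y = (c / (32 * \<gamma>))\<^sup>2" by (simp add: y_def power_divide power_mult_distrib)
    also have "sqrt \<dots> = c / (32 * \<gamma>)" using assms by simp
    finally have "sqrt k * (32 * \<gamma>) \<le> c" using assms by (simp add: pos_le_divide_eq)
    moreover have "sqrt k > 0" using k(1) by (auto intro: Nat.gr0I)
    ultimately show ?thesis by (simp add: pos_le_divide_eq mult_ac)
  qed
  ultimately show ?thesis using k(1) by blast
qed

theorem theorem5:
  fixes c :: real
  assumes "0 < c" and "c \<le> 1"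
  shows "\<exists>K\<^sub>1 > 0. \<exists>K\<^sub>2 > 0. \<forall>(\<gamma>::real) (s::nat).
    0 < \<gamma> \<longrightarrow> \<gamma> \<le> 1 / 2 \<longrightarrow> real s \<ge> K\<^sub>1 / \<gamma>\<^sup>2 \<longrightarrow>
    (\<exists>(N::nat) (F :: (nat \<Rightarrow> int) \<Rightarrow> int).
       F \<in> sign_cube N \<rightarrow> {-1, 1} \<and>
       (\<forall>C. wf_circuit N C \<longrightarrow> circuit_size C \<le> s \<longrightarrow>
          real (card {x \<in> sign_cube N. circuit_fun N C x = F x})
            \<le> 99 / 100 * real (card (sign_cube N))) \<and>
       (\<forall>H :: (nat \<Rightarrow> int) pmf. has_density H (sign_cube N) c \<longrightarrow>
          (\<exists>C. wf_circuit N C \<and> real (circuit_size C) \<le> K\<^sub>2 * (real s * \<gamma>\<^sup>2) \<and>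
             measure_pmf.prob H {x. circuit_fun N C x = F x} \<ge> 1 / 2 + \<gamma>)))"
proof -
  \<comment> \<open>Four gates per element of \<open>U i\<close>, with
    \<open>B \<le> 300 * s / k + 1\<close> and
    \<open>1 / k \<le> 3072 * \<gamma>\<^sup>2 / c\<^sup>2\<close>; the rounding term is absorbed by
    \<open>1 \<le> s * \<gamma>\<^sup>2\<close>.\<close>
  define K\<^sub>2 where "K\<^sub>2 = 4 * (300 * 3072 / c\<^sup>2 + 1)"
  have "K\<^sub>2 > 0" using assms by (simp add: K\<^sub>2_def add_pos_pos)
  show ?thesis
  \<comment> \<open>The choice \<open>K\<^sub>1 = 1\<close> works because
    \<open>k \<le> 1 / \<gamma>\<^sup>2 \<le> s\<close>.\<close>
  proof (rule exI[of _ 1], intro conjI exI[of _ K\<^sub>2] allI impI)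
    fix \<gamma> :: real and s :: nat
    assume \<gamma>: "0 < \<gamma>" "\<gamma> \<le> 1 / 2" and s: "1 / \<gamma>\<^sup>2 \<le> real s"
    obtain k where k: "odd k" "k = 1 \<or> \<gamma> \<le> c / (32 * sqrt k)" "real k \<le> 1 / \<gamma>\<^sup>2"
      "c\<^sup>2 / (3072 * \<gamma>\<^sup>2) \<le> real k"
      using exists_majority_size[OF assms \<gamma>] by blast
    have kpos: "0 < k" using k(1) by (auto intro: Nat.gr0I)
    have ks: "k \<le> s" using k(3) s by linarith
    define B where "B = 300 * s div k + 1"
    have B: "300 * s \<le> B * k"
      unfolding B_def using dividend_less_div_times[OF kpos, of "300 * s"] by simp
    define M where "M = k + B + s + 2"
    define N where "N = k + B * M"
    have kN: "k \<le> N" by (simp add: N_def)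
    obtain U where U: "\<And>i. i < k \<Longrightarrow> U i \<subseteq> {k..<N}" "\<And>i. i < k \<Longrightarrow> card (U i) = B"
      and hard: "\<And>C. wf_circuit N C \<Longrightarrow> circuit_size C \<le> s \<Longrightarrow>
        real (card {x \<in> sign_cube N. circuit_fun N C x = character_majority k U x}) \<le> 99 / 100 * 2 ^ N"
      using exists_hard_majority[OF kpos ks B M_def N_def] by blast
    have size: "real (4 * B) \<le> K\<^sub>2 * (real s * \<gamma>\<^sup>2)"
    proof -
      have "real B \<le> 300 * real s / real k + 1"
        using of_nat_div_le_of_nat[of "300 * s" k, where 'a = real] by (simp add: B_def)
      also have "300 * real s / real k \<le> 300 * real s / (c\<^sup>2 / (3072 * \<gamma>\<^sup>2))"
        using k(4) assms \<gamma> kpos by (intro divide_left_mono) auto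
      also have "\<dots> = 300 * 3072 / c\<^sup>2 * (real s * \<gamma>\<^sup>2)" by simp
      also have "(1::real) \<le> real s * \<gamma>\<^sup>2" using s \<gamma> by (simp add: pos_divide_le_eq)
      finally have "real B \<le> (300 * 3072 / c\<^sup>2 + 1) * (real s * \<gamma>\<^sup>2)"
        by (simp only: distrib_right mult_1 add_left_mono)
      then have "4 * real B \<le> 4 * ((300 * 3072 / c\<^sup>2 + 1) * (real s * \<gamma>\<^sup>2))" by linarith
      then show ?thesis by (simp only: K\<^sub>2_def mult.assoc of_nat_mult of_nat_numeral)
    qed
    show "\<exists>(N::nat) (F :: (nat \<Rightarrow> int) \<Rightarrow> int).
       F \<in> sign_cube N \<rightarrow> {-1, 1} \<and>
       (\<forall>C. wf_circuit N C \<longrightarrow> circuit_size C \<le> s \<longrightarrow>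
          real (card {x \<in> sign_cube N. circuit_fun N C x = F x})
            \<le> 99 / 100 * real (card (sign_cube N))) \<and>
       (\<forall>H :: (nat \<Rightarrow> int) pmf. has_density H (sign_cube N) c \<longrightarrow>
          (\<exists>C. wf_circuit N C \<and> real (circuit_size C) \<le> K\<^sub>2 * (real s * \<gamma>\<^sup>2) \<and>
             measure_pmf.prob H {x. circuit_fun N C x = F x} \<ge> 1 / 2 + \<gamma>))"
    proof (intro exI[of _ N] exI[of _ "character_majority k U"] conjI allI impI)
      show "character_majority k U \<in> sign_cube N \<rightarrow> {-1, 1}"
        by (auto simp: character_majority_def)
      show "real (card {x \<in> sign_cube N. circuit_fun N C x = character_majority k U x})
          \<le> 99 / 100 * real (card (sign_cube N))" if "wf_circuit N C" "circuit_size C \<le> s" for C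
        using hard[OF that] by (simp add: card_sign_cube)
      fix H :: "(nat \<Rightarrow> int) pmf" assume H: "has_density H (sign_cube N) c"
      define agree where "agree i = measure_pmf.prob H
        {x \<in> sign_cube N. character (insert i (U i)) x = character_majority k U x}" for i
      obtain i where i: "i < k" "1 / 2 + \<gamma> \<le> agree i"
      proof (cases "k = 1")
        case True
        \<comment> \<open>A single character is its own majority, so agreement is certain and
          \<open>\<gamma> \<le> 1 / 2\<close> suffices.\<close>
        have eq: "character (insert 0 (U 0)) x = character_majority k U x" if "x \<in> sign_cube N" for x
          using character_values[OF that, of "insert 0 (U 0)"] U(1)[of 0] True kN
          by (fastforce simp: character_majority_def character_sum_def)
        have "agree 0 = (\<Sum>x\<in>sign_cube N. pmf H x)"
          unfolding agree_def by (subst measure_measure_pmf_finite) (auto simp: eq intro!: sum.cong)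
        also have "\<dots> = 1" using H by (intro sum_pmf_eq_1) (auto simp: has_density_def)
        finally show ?thesis using that[of 0] True \<gamma>(2) by simp
      next
        case False
        then show ?thesis
          using exists_correlated_character[OF kN U(1) k(1) assms(1) H] k(2) that
          unfolding agree_def by (meson add_left_mono order_trans)
      qed
      obtain C where C: "wf_circuit N C" "circuit_size C = 4 * card (U i)"
        "\<And>x. x \<in> sign_cube N \<Longrightarrow> circuit_fun N C x = character (insert i (U i)) x"
        using character_circuit[of i N "U i"] U(1)[OF i(1)] i(1) kN by fastforce
      have "1 / 2 + \<gamma> \<le> agree i" by (rule i(2))
      also have "\<dots> \<le> measure_pmf.prob H {x. circuit_fun N C x = character_majority k U x}"
        unfolding agree_def by (intro measure_pmf.finite_measure_mono) (auto simp: C(3))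
      finally show "\<exists>C. wf_circuit N C \<and> real (circuit_size C) \<le> K\<^sub>2 * (real s * \<gamma>\<^sup>2) \<and>
          measure_pmf.prob H {x. circuit_fun N C x = character_majority k U x} \<ge> 1 / 2 + \<gamma>"
        using C(1,2) U(2)[OF i(1)] size by auto
    qed
  qed (use \<open>K\<^sub>2 > 0\<close> in auto)
qed

end
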